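(* Let $I\subset R=\Bbbk[x_0,\ldots,x_n]$ be a nonzero proper monomial ideal and let $\mathcal{Q}\subseteq\mathbb{R}^{n+1}$ be its symbolic polyhedron. Then $\alpha(\mathcal{Q})=\gamma(I)$.
   Context: $\Bbbk$ is a field. $\operatorname{Ass}(I)$ is the set of associated primes of $I$ (of $R/I$), and $\operatorname{maxAss}(I)$ is the subset of those maximal with respect to inclusion. The $m$-th symbolic power is $I^{(m)} = R\cap\bigcap_{P\in \operatorname{Ass}(I)} I^m R_P$. For a nonzero homogeneous ideal $J$, $\alpha(J)$ is the least degree $d$ with $J_d\ne 0$. The Waldschmidt constant of $I$ is $\gamma(I)=\lim_{m\to\infty}\alpha(I^{(m)})/m$ (this limit is known to exist). For $P\in\operatorname{maxAss}(I)$ put $Q_{\subseteq P}=R\cap I R_P$, a monomial ideal. For a monomial ideal $M$, $\mathcal{L}(M)=\{\mathbf{a}\in\mathbb{N}^{n+1}\mid \mathbf{x}^{\mathbf{a}}\in M\}$, where $\mathbb{N}$ is the set of non-negative integers and $\mathbf{x}^{\mathbf a}=x_0^{a_0}\cdots x_n^{a_n}$. The symbolic polyhedron of $I$ is $\mathcal{Q}=\bigcap_{P\in\operatorname{maxAss}(I)}\operatorname{conv}(\mathcal{L}(Q_{\subseteq P}))\subseteq\mathbb{R}^{n+1}$ ($\operatorname{conv}$ denotes convex hull), and $\alpha(\mathcal{Q})=\min\{a_0+\cdots+a_n\mid (a_0,\ldots,a_n)\in\mathcal{Q}\}$. *)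

theory Defs
  imports
    "HOL-Analysis.Analysis"
    "HOL-Library.Poly_Mapping"
    "HOL-Computational_Algebra.Polynomial_Factorial"
begin
text \<open>
  The finite linearly ordered type \<open>'v\<close> is the index set of the variables; its elements play the
  role of \<open>0 < \<dots> < n\<close>, so \<open>CARD('v) = n + 1\<close>.  The order is what makes \<open>Poly_Mapping\<close> provide
  the \<open>idom\<close> instance, and hence the fraction field of the polynomial ring; none of the
  definitions below depends on it.
\<close>

type_synonym ('v, 'k) mpol = "('v \<Rightarrow>\<^sub>0 nat) \<Rightarrow>\<^sub>0 'k"

abbreviation is_ideal :: "'a::comm_ring_1 set \<Rightarrow> bool" where
  "is_ideal \<equiv> module.subspace (*)"

abbreviation ideal_gen :: "'a::comm_ring_1 set \<Rightarrow> 'a set" where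
  "ideal_gen \<equiv> module.span (*)"

lemma module_times: "module ((*) :: 'a::comm_ring_1 \<Rightarrow> 'a \<Rightarrow> 'a)"
  by unfold_locales (simp_all add: algebra_simps)

definition prime_ideal :: "'a::comm_ring_1 set \<Rightarrow> bool" where
  "prime_ideal P \<longleftrightarrow> is_ideal P \<and> P \<noteq> UNIV \<and> (\<forall>a b. a * b \<in> P \<longrightarrow> a \<in> P \<or> b \<in> P)"

definition ideal_power :: "'a::comm_ring_1 set \<Rightarrow> nat \<Rightarrow> 'a set" where
  "ideal_power I m = ideal_gen {\<Prod>i<m. f i |f. \<forall>i<m. f i \<in> I}"

definition monom_exp :: "('v \<Rightarrow>\<^sub>0 nat) \<Rightarrow> ('v, 'k::comm_ring_1) mpol" where
  "monom_exp a = Poly_Mapping.single a 1"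

definition monomial_ideal :: "('v, 'k::comm_ring_1) mpol set \<Rightarrow> bool" where
  "monomial_ideal I \<longleftrightarrow> (\<exists>A. I = ideal_gen (monom_exp ` A))"

definition Ass :: "'a::comm_ring_1 set \<Rightarrow> 'a set set" where
  "Ass I = {P. prime_ideal P \<and> (\<exists>f. P = {g. g * f \<in> I})}"

definition maxAss :: "'a::comm_ring_1 set \<Rightarrow> 'a set set" where
  "maxAss I = {P \<in> Ass I. \<forall>P'\<in>Ass I. P \<subseteq> P' \<longrightarrow> P' = P}"

text \<open>\<open>R\<^sub>P\<close> as a subring of the fraction field, and the ideal \<open>J R\<^sub>P\<close> that \<open>J\<close> generates in it.\<close>

definition localization :: "'a::idom set \<Rightarrow> 'a fract set" where
  "localization P = {Fraction_Field.Fract a s |a s. s \<notin> P}"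

definition extended_ideal :: "'a::idom set \<Rightarrow> 'a set \<Rightarrow> 'a fract set" where
  "extended_ideal J P =
    {\<Sum>i<k. to_fract (f i) * r i |(k::nat) f r. \<forall>i<k. f i \<in> J \<and> r i \<in> localization P}"

definition symbolic_power :: "'a::idom set \<Rightarrow> nat \<Rightarrow> 'a set" where
  "symbolic_power I m = to_fract -` (\<Inter>P\<in>Ass I. extended_ideal (ideal_power I m) P)"

definition contracted_local :: "'a::idom set \<Rightarrow> 'a set \<Rightarrow> 'a set" where
  "contracted_local I P = to_fract -` extended_ideal I P"

definition homogeneous_of_degree :: "nat \<Rightarrow> ('v::finite, 'k::zero) mpol \<Rightarrow> bool" where
  "homogeneous_of_degree d f \<longleftrightarrow>
    (\<forall>a\<in>Poly_Mapping.keys f. (\<Sum>i\<in>UNIV. Poly_Mapping.lookup a i) = d)"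

definition initial_degree :: "('v::finite, 'k::zero) mpol set \<Rightarrow> nat" where
  "initial_degree J = (LEAST d. \<exists>f\<in>J. f \<noteq> 0 \<and> homogeneous_of_degree d f)"

definition waldschmidt_constant :: "('v::{finite,linorder}, 'k::field) mpol set \<Rightarrow> real" where
  "waldschmidt_constant I = lim (\<lambda>m. real (initial_degree (symbolic_power I m)) / real m)"

definition lattice_points :: "('v::finite, 'k::comm_ring_1) mpol set \<Rightarrow> (real ^ 'v) set" where
  "lattice_points M = {(\<chi> i. real (Poly_Mapping.lookup a i)) |a. monom_exp a \<in> M}"

definition symbolic_polyhedron ::
  "('v::{finite,linorder}, 'k::field) mpol set \<Rightarrow> (real ^ 'v::{finite,linorder}) set" where
  "symbolic_polyhedron I = (\<Inter>P\<in>maxAss I. convex hull (lattice_points (contracted_local I P)))"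

text \<open>\<open>Least\<close> on the reals denotes an attained minimum and is unspecified if there is none.\<close>

definition min_degree :: "(real ^ 'v::finite) set \<Rightarrow> real" where
  "min_degree Q = (LEAST d. \<exists>a\<in>Q. d = (\<Sum>i\<in>UNIV. a $ i))"

end

theory Submission
  imports Defs
begin

text \<open>
  Monomial ideals correspond to subsets \<open>U\<close> of \<open>\<nat>\<^sup>n\<^sup>+\<^sup>1\<close> closed under adding vectors.
  Under this correspondence the \<open>m\<close>-th power becomes the \<open>m\<close>-fold sumset, and contraction from
  \<open>R\<^sub>P\<close>, which depends only on the variables in \<open>P\<close>, commutes with it. Hence \<open>x\<^sup>a \<in> I\<^sup>(\<^sup>m\<^sup>)\<close> iff
  \<open>a\<close> lies in the \<open>m\<close>-fold sumset of \<open>\<L>(Q\<^sub>\<subseteq>\<^sub>P)\<close> for every maximal associated prime \<open>P\<close>.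
  In that case \<open>a / m\<close> lies in the symbolic polyhedron, so \<open>\<alpha>(I\<^sup>(\<^sup>m\<^sup>)) / m \<ge> \<alpha>(\<Q>)\<close>.
  Conversely, for a point \<open>q\<close> of the polyhedron of minimal degree and \<open>x\<^sup>w \<in> I\<close>, rounding \<open>m q\<close> up and
  adding \<open>(n + 2) w\<close> gives an exponent of \<open>I\<^sup>(\<^sup>m\<^sup>)\<close>, so
  \<open>\<alpha>(I\<^sup>(\<^sup>m\<^sup>)) \<le> m \<alpha>(\<Q>) + C\<close> with \<open>C\<close> independent of \<open>m\<close>. This squeezes \<open>\<alpha>(I\<^sup>(\<^sup>m\<^sup>)) / m\<close>, without
  a separate subadditivity argument for the limit. The minimum \<open>\<alpha>(\<Q>)\<close> is attained since by
  Dickson's lemma the convex hulls are closed.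
\<close>

subsection \<open>Monomial ideals and their powers\<close>

lemmas ideal_0 = module.subspace_0[OF module_times]
lemmas ideal_add = module.subspace_add[OF module_times]
lemmas ideal_diff = module.subspace_diff[OF module_times]
lemmas ideal_mult = module.subspace_scale[OF module_times]
lemmas ideal_sum = module.subspace_sum[OF module_times]

definition upset :: "'a::plus set \<Rightarrow> bool" where
  "upset U \<longleftrightarrow> (\<forall>a\<in>U. \<forall>b. a + b \<in> U)"

text \<open>For an upset \<open>U\<close>, the monomial ideal with exponent set \<open>U\<close>;
  membership becomes a condition on each exponent separately.\<close>

definition poly_supp :: "('v \<Rightarrow>\<^sub>0 nat) set \<Rightarrow> ('v, 'k::comm_ring_1) mpol set" where
  "poly_supp U = {g. Poly_Mapping.keys g \<subseteq> U}"

lemma keys_monom_exp [simp]: "Poly_Mapping.keys (monom_exp a :: ('v, 'k::comm_ring_1) mpol) = {a}"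
  by (simp add: monom_exp_def)

lemma monom_exp_in_poly_supp [simp]:
  "(monom_exp a :: ('v, 'k::comm_ring_1) mpol) \<in> poly_supp U \<longleftrightarrow> a \<in> U"
  by (simp add: poly_supp_def)

lemma monom_exp_add: "monom_exp (a + b) = monom_exp a * (monom_exp b :: ('v, 'k::comm_ring_1) mpol)"
  by (simp add: monom_exp_def mult_single)

lemma monom_exp_0: "monom_exp 0 = (1 :: ('v, 'k::comm_ring_1) mpol)"
  by (simp add: monom_exp_def)

lemma is_ideal_poly_supp:
  assumes "upset U"
  shows "is_ideal (poly_supp U :: ('v, 'k::comm_ring_1) mpol set)"
proof -
  have "x + y \<in> poly_supp U" if "x \<in> poly_supp U" "y \<in> poly_supp U" for x y :: "('v, 'k) mpol"
    using that Poly_Mapping.keys_add[of x y] by (auto simp: poly_supp_def)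
  moreover have "c * x \<in> poly_supp U" if "x \<in> poly_supp U" for c x :: "('v, 'k) mpol"
    using that Poly_Mapping.keys_mult[of c x] assms
    by (force simp: poly_supp_def upset_def add.commute)
  moreover have "0 \<in> poly_supp U" by (simp add: poly_supp_def)
  ultimately show ?thesis unfolding module.subspace_def[OF module_times] by blast
qed

lemma poly_mapping_expand:
  "g = (\<Sum>a\<in>Poly_Mapping.keys g. Poly_Mapping.single a (Poly_Mapping.lookup g a))"
  by (rule poly_mapping_eqI)
     (auto simp: lookup_sum lookup_single when_def in_keys_iff sum.delta[OF finite_keys])

text \<open>A polynomial is the sum of its terms, and a term is a constant \<open>single 0 c\<close>
  times a monomial.\<close>

lemma poly_supp_subset_ideal:
  assumes "is_ideal J" and "\<And>a. a \<in> U \<Longrightarrow> (monom_exp a :: ('v, 'k::comm_ring_1) mpol) \<in> J"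
  shows "poly_supp U \<subseteq> J"
proof
  fix g :: "('v, 'k) mpol" assume g: "g \<in> poly_supp U"
  have "Poly_Mapping.single a (Poly_Mapping.lookup g a) \<in> J" if "a \<in> Poly_Mapping.keys g" for a
  proof -
    have "Poly_Mapping.single 0 (Poly_Mapping.lookup g a) * monom_exp a \<in> J"
      using that g by (intro ideal_mult assms) (auto simp: poly_supp_def)
    then show ?thesis by (simp add: monom_exp_def mult_single)
  qed
  then show "g \<in> J" by (subst poly_mapping_expand) (rule ideal_sum[OF assms(1)])
qed

lemma monomial_idealE:
  assumes "monomial_ideal (I :: ('v, 'k::comm_ring_1) mpol set)"
  obtains U where "upset U" and "I = poly_supp U"
proof -
  obtain A where A: "I = ideal_gen (monom_exp ` A)"
    using assms by (auto simp: monomial_ideal_def)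
  define U where "U = {a + b |a b. a \<in> A}"
  have U: "upset U" unfolding upset_def U_def by (force simp: add.assoc)
  have "monom_exp ` A \<subseteq> (poly_supp U :: ('v, 'k) mpol set)"
    unfolding U_def by clarsimp (metis add.right_neutral)
  then have "I \<subseteq> poly_supp U"
    unfolding A by (rule module.span_minimal[OF module_times _ is_ideal_poly_supp[OF U]])
  moreover have "poly_supp U \<subseteq> I"
  proof (rule poly_supp_subset_ideal)
    show ideal: "is_ideal I" unfolding A by (rule module.subspace_span[OF module_times])
    fix c assume "c \<in> U"
    then obtain a b where "a \<in> A" "c = a + b" by (auto simp: U_def)
    moreover have "monom_exp a \<in> I" if "a \<in> A" for a
      unfolding A using that by (intro module.span_base[OF module_times]) auto
    ultimately show "(monom_exp c :: ('v, 'k) mpol) \<in> I"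
      using ideal_mult[OF ideal, of "monom_exp a" "monom_exp b"]
      by (simp add: monom_exp_add mult.commute)
  qed
  ultimately show thesis using that[OF U] by blast
qed

text \<open>The base is \<open>UNIV\<close> and not \<open>{0}\<close>: the zeroth power of an ideal
  is the whole ring, and every \<open>msum U m\<close> stays an upset.\<close>

primrec msum :: "('a::comm_monoid_add) set \<Rightarrow> nat \<Rightarrow> 'a set" where
  "msum U 0 = UNIV"
| "msum U (Suc m) = {a + b |a b. a \<in> U \<and> b \<in> msum U m}"

lemma upset_msum:
  assumes "upset U"
  shows "upset (msum U m)"
proof (cases m)
  case (Suc k)
  show ?thesis unfolding upset_def
  proof safe
    fix x y assume "x \<in> msum U m"
    then obtain a b where ab: "a \<in> U" "b \<in> msum U k" "x = a + b" by (auto simp: Suc)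
    then have "x + y = (a + y) + b" and "a + y \<in> U"
      using assms by (auto simp: ac_simps upset_def)
    then show "x + y \<in> msum U m" using ab(2) unfolding Suc msum.simps by blast
  qed
qed (simp add: upset_def)

lemma msum_add:
  assumes "upset U" and "a \<in> msum U m" and "b \<in> msum U l"
  shows "a + b \<in> msum U (m + l)"
  using assms(2)
proof (induction m arbitrary: a)
  case 0
  then show ?case using upset_msum[OF assms(1), of l] assms(3)
    by (auto simp: upset_def add.commute)
next
  case (Suc m)
  then obtain c d where "c \<in> U" "d \<in> msum U m" "a = c + d" by auto
  with Suc.IH[of d] have "a + b = c + (d + b)" "d + b \<in> msum U (m + l)" by (auto simp: add.assoc)
  with \<open>c \<in> U\<close> show ?case unfolding add_Suc msum.simps by blast
qed

lemma prod_in_poly_supp: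
  assumes "\<And>i. i < m \<Longrightarrow> (f i :: ('v, 'k::comm_ring_1) mpol) \<in> poly_supp U"
  shows "(\<Prod>i<m. f i) \<in> poly_supp (msum U m)"
  using assms
proof (induction m)
  case (Suc m)
  have "(\<Prod>i<m. f i) \<in> poly_supp (msum U m)" and "f m \<in> poly_supp U"
    using Suc by auto
  then have "Poly_Mapping.keys (f m * (\<Prod>i<m. f i)) \<subseteq> msum U (Suc m)"
    using Poly_Mapping.keys_mult[of "f m" "\<Prod>i<m. f i"]
    unfolding poly_supp_def msum.simps by blast
  then show ?case by (simp add: poly_supp_def mult.commute)
qed (simp add: poly_supp_def)

lemma monom_exp_in_ideal_power:
  assumes "upset U" and "a \<in> msum U m"
  shows "(monom_exp a :: ('v, 'k::comm_ring_1) mpol) \<in> ideal_power (poly_supp U) m"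
proof -
  \<comment> \<open>The cofactor \<open>monom_exp e\<close> takes up the arbitrary exponent left
    over at \<open>msum U 0 = UNIV\<close>.\<close>
  have "\<exists>f e. (\<forall>i<m. f i \<in> (poly_supp U :: ('v, 'k) mpol set)) \<and>
      monom_exp a = monom_exp e * (\<Prod>i<m. f i)"
    using assms(2)
  proof (induction m arbitrary: a)
    case (Suc m)
    then obtain c d where cd: "c \<in> U" "d \<in> msum U m" "a = c + d" by auto
    obtain f e where f: "\<forall>i<m. f i \<in> (poly_supp U :: ('v, 'k) mpol set)"
      "monom_exp d = monom_exp e * (\<Prod>i<m. f i)"
      using Suc.IH[OF cd(2)] by auto
    show ?case using cd f
      by (intro exI[of _ "f(m := monom_exp c)"] exI[of _ e])
         (auto simp: less_Suc_eq monom_exp_add algebra_simps cong: prod.cong_simp)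
  qed auto
  then obtain f e where f: "\<forall>i<m. f i \<in> (poly_supp U :: ('v, 'k) mpol set)"
      "monom_exp a = monom_exp e * (\<Prod>i<m. f i)" by auto
  have "(\<Prod>i<m. f i) \<in> ideal_power (poly_supp U) m"
    unfolding ideal_power_def using f(1) by (intro module.span_base[OF module_times]) blast
  then show ?thesis
    unfolding f(2) ideal_power_def by (rule module.span_scale[OF module_times])
qed

lemma ideal_power_poly_supp:
  assumes "upset U"
  shows "ideal_power (poly_supp U :: ('v, 'k::comm_ring_1) mpol set) m = poly_supp (msum U m)"
proof
  have "{\<Prod>i<m. f i |f. \<forall>i<m. f i \<in> poly_supp U} \<subseteq> (poly_supp (msum U m) :: ('v, 'k) mpol set)"
    by (auto intro!: prod_in_poly_supp)
  then show "ideal_power (poly_supp U :: ('v, 'k) mpol set) m \<subseteq> poly_supp (msum U m)"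
    unfolding ideal_power_def
    by (rule module.span_minimal[OF module_times _ is_ideal_poly_supp[OF upset_msum[OF assms]]])
  show "poly_supp (msum U m) \<subseteq> ideal_power (poly_supp U :: ('v, 'k) mpol set) m"
    by (rule poly_supp_subset_ideal)
       (use assms in \<open>auto simp: ideal_power_def module.subspace_span[OF module_times]
          intro!: monom_exp_in_ideal_power[unfolded ideal_power_def]\<close>)
qed

subsection \<open>Contraction from a localization\<close>

lemma one_notin_prime: "prime_ideal (P :: 'a::idom set) \<Longrightarrow> 1 \<notin> P"
proof
  assume P: "prime_ideal P" and "1 \<in> P"
  then have "c * 1 \<in> P" for c
    by (intro ideal_mult) (auto simp: prime_ideal_def)
  then show False using P by (auto simp: prime_ideal_def)
qed

text \<open>Common denominators: the complement of a prime is closed under products and avoids 0, so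
  the sum collapses to one fraction with numerator in \<open>J\<close>.\<close>

lemma extended_ideal_subset:
  fixes f :: "nat \<Rightarrow> 'a::idom"
  assumes P: "prime_ideal P" and J: "is_ideal J"
    and f: "\<forall>i<k. f i \<in> J \<and> r i \<in> localization P"
  shows "\<exists>g\<in>J. \<exists>s. s \<notin> P \<and> (\<Sum>i<k. to_fract (f i) * r i) = Fraction_Field.Fract g s"
  using f
proof (induction k)
  case 0
  then show ?case
    using ideal_0[OF J] one_notin_prime[OF P] by (intro bexI[of _ 0] exI[of _ 1]) (auto simp: Zero_fract_def)
next
  case (Suc k)
  then obtain g s where g: "g \<in> J" "s \<notin> P"
    "(\<Sum>i<k. to_fract (f i) * r i) = Fraction_Field.Fract g s" by fastforce
  obtain b t where b: "r k = Fraction_Field.Fract b t" "t \<notin> P"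
    using Suc.prems by (auto simp: localization_def)
  have fk: "f k \<in> J" using Suc.prems by auto
  have "0 \<in> P" using P ideal_0 by (auto simp: prime_ideal_def)
  then have nz: "s \<noteq> 0" "t \<noteq> 0" using g b by auto
  have "t * g + (s * b) * f k \<in> J"
    using J fk g(1) by (intro ideal_add ideal_mult)
  moreover have "s * t \<notin> P" using g b P by (auto simp: prime_ideal_def)
  moreover have "(\<Sum>i<Suc k. to_fract (f i) * r i)
      = Fraction_Field.Fract g s + Fraction_Field.Fract (f k) 1 * Fraction_Field.Fract b t"
    by (simp add: g(3) b(1) flip: to_fract_def)
  with nz have "(\<Sum>i<Suc k. to_fract (f i) * r i) = Fraction_Field.Fract (t * g + (s * b) * f k) (s * t)"
    by (simp add: algebra_simps)
  ultimately show ?case by blast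
qed

text \<open>Trades the fraction field for a condition in the ring: clear the denominator one way,
  divide by \<open>s\<close> the other.\<close>

lemma to_fract_in_extended_ideal_iff:
  assumes P: "prime_ideal (P :: 'a::idom set)" and J: "is_ideal J"
  shows "to_fract f \<in> extended_ideal J P \<longleftrightarrow> (\<exists>s. s \<notin> P \<and> s * f \<in> J)"
proof
  have "0 \<in> P" using P ideal_0 by (auto simp: prime_ideal_def)
  then have nz: "s \<notin> P \<Longrightarrow> s \<noteq> 0" for s by auto
  {
    assume "to_fract f \<in> extended_ideal J P"
    then obtain k r h where hr: "to_fract f = (\<Sum>i<(k::nat). to_fract (h i) * r i)"
        and "\<forall>i<k. h i \<in> J \<and> r i \<in> localization P"
      unfolding extended_ideal_def by blast
    then obtain g s where "g \<in> J" "s \<notin> P" "to_fract f = Fraction_Field.Fract g s"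
      using extended_ideal_subset[OF P J, of k h r] unfolding hr by blast
    moreover from this have "s * f = g" using nz by (auto simp: to_fract_def eq_fract mult.commute)
    ultimately show "\<exists>s. s \<notin> P \<and> s * f \<in> J" by blast
  next
    assume "\<exists>s. s \<notin> P \<and> s * f \<in> J"
    then obtain s where s: "s \<notin> P" "s * f \<in> J" by blast
    have eq: "to_fract f = (\<Sum>i<Suc 0. to_fract (s * f) * Fraction_Field.Fract 1 s)"
      using nz[OF s(1)] by (simp add: to_fract_def eq_fract mult.commute)
    have "Fraction_Field.Fract 1 s \<in> localization P"
      using s by (auto simp: localization_def)
    then show "to_fract f \<in> extended_ideal J P"
      unfolding extended_ideal_def mem_Collect_eq eq using s
      by (intro exI[of _ "Suc 0"] exI[of _ "\<lambda>_. s * f"] exI[of _ "\<lambda>_. Fraction_Field.Fract 1 s"]) simp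
  }
qed

text \<open>
  Exponent set of the contraction to \<open>R\<close> of the localization at \<open>(x\<^sub>v | v \<in> S)\<close> of the monomial
  ideal with exponent set \<open>U\<close>: variables outside \<open>S\<close> become units.
\<close>

definition sat :: "'v set \<Rightarrow> ('v \<Rightarrow>\<^sub>0 nat) set \<Rightarrow> ('v \<Rightarrow>\<^sub>0 nat) set" where
  "sat S U = {a. \<exists>b. (\<forall>v\<in>S. Poly_Mapping.lookup b v = 0) \<and> a + b \<in> U}"

text \<open>For a prime \<open>P\<close> these variables alone decide which monomials lie in
  \<open>P\<close>; see \<open>monom_exp_in_prime_iff\<close>.\<close>

definition vars_in :: "('v, 'k::comm_ring_1) mpol set \<Rightarrow> 'v set" where
  "vars_in P = {v. monom_exp (Poly_Mapping.single v 1) \<in> P}"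

text \<open>Serves on two levels: it selects terms of a polynomial, and coordinates of an exponent
  vector.\<close>

definition restr :: "'a set \<Rightarrow> ('a \<Rightarrow>\<^sub>0 'b::comm_monoid_add) \<Rightarrow> 'a \<Rightarrow>\<^sub>0 'b" where
  "restr T g = (\<Sum>a\<in>Poly_Mapping.keys g \<inter> T. Poly_Mapping.single a (Poly_Mapping.lookup g a))"

lemma lookup_restr:
  "Poly_Mapping.lookup (restr T g) a = (if a \<in> T then Poly_Mapping.lookup g a else 0)"
  by (auto simp: restr_def lookup_sum lookup_single when_def in_keys_iff sum.delta)

lemma keys_restr [simp]: "Poly_Mapping.keys (restr T g) = Poly_Mapping.keys g \<inter> T"
  by (auto simp: in_keys_iff lookup_restr split: if_splits)

lemma restr_compl: "restr T g + restr (- T) g = g"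
  by (rule poly_mapping_eqI) (auto simp: lookup_add lookup_restr)

lemma upset_sat:
  assumes "upset U"
  shows "upset (sat S U)"
  unfolding upset_def sat_def
proof safe
  fix a b c assume "\<forall>v\<in>S. Poly_Mapping.lookup c v = 0" "a + c \<in> U"
  then show "\<exists>c. (\<forall>v\<in>S. Poly_Mapping.lookup c v = 0) \<and> a + b + c \<in> U"
    using assms by (intro exI[of _ c]) (metis (no_types) add.assoc add.commute upset_def)
qed

lemma sat_antimono: "S \<subseteq> S' \<Longrightarrow> sat S' U \<subseteq> sat S U"
  unfolding sat_def by blast

lemma subset_sat: "U \<subseteq> sat S U"
  unfolding sat_def by (intro subsetI CollectI exI[of _ 0]) simp

text \<open>Contraction commutes with powers: coordinates outside \<open>S\<close> are free after
  \<open>sat S\<close> and can be shifted between summands.\<close>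

lemma sat_msum:
  fixes U :: "('v \<Rightarrow>\<^sub>0 nat) set"
  assumes U: "upset U"
  shows "sat S (msum U m) = msum (sat S U) m"
proof (induction m)
  case 0
  then show ?case using subset_sat[of UNIV S] by auto
next
  case (Suc m)
  show ?case
  proof (intro equalityI subsetI)
    fix a assume "a \<in> sat S (msum U (Suc m))"
    then obtain b c e where b: "\<forall>v\<in>S. Poly_Mapping.lookup b v = 0"
      and ce: "c \<in> U" "e \<in> msum U m" "a + b = c + e"
      by (auto simp: sat_def)
    have c: "restr S c \<in> sat S U"
      using ce(1) unfolding sat_def
      by (intro CollectI exI[of _ "restr (- S) c"]) (simp add: restr_compl lookup_restr)
    have "restr S e \<in> sat S (msum U m)"
      using ce(2) unfolding sat_def
      by (intro CollectI exI[of _ "restr (- S) e"]) (simp add: restr_compl lookup_restr)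
    then have e: "restr S e + restr (- S) a \<in> msum (sat S U) m"
      using upset_msum[OF upset_sat[OF U]] unfolding Suc.IH upset_def by blast
    \<comment> \<open>On \<open>S\<close> the vector \<open>b\<close> vanishes, so \<open>a\<close>
      equals \<open>c + e\<close> there; outside \<open>S\<close> the second summand carries all of
      \<open>a\<close>.\<close>
    have "a = restr S c + (restr S e + restr (- S) a)"
    proof (rule poly_mapping_eqI)
      fix v
      have "Poly_Mapping.lookup (a + b) v = Poly_Mapping.lookup (c + e) v" using ce by simp
      then show "Poly_Mapping.lookup a v
          = Poly_Mapping.lookup (restr S c + (restr S e + restr (- S) a)) v"
        using b by (auto simp: lookup_add lookup_restr)
    qed
    with c e show "a \<in> msum (sat S U) (Suc m)" unfolding msum.simps by blast
  next
    fix a assume "a \<in> msum (sat S U) (Suc m)"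
    then obtain c e where ce: "c \<in> sat S U" "e \<in> sat S (msum U m)" "a = c + e"
      using Suc.IH by auto
    then obtain c' e' where "\<forall>v\<in>S. Poly_Mapping.lookup c' v = 0" "c + c' \<in> U"
      "\<forall>v\<in>S. Poly_Mapping.lookup e' v = 0" "e + e' \<in> msum U m"
      by (auto simp: sat_def)
    then have "\<forall>v\<in>S. Poly_Mapping.lookup (c' + e') v = 0"
      and "(c + c') + (e + e') \<in> msum U (Suc m)"
      unfolding msum.simps by (simp_all add: lookup_add) blast
    moreover have "a + (c' + e') = (c + c') + (e + e')" using ce(3) by (simp add: ac_simps)
    ultimately show "a \<in> sat S (msum U (Suc m))"
      unfolding sat_def by (intro CollectI exI[of _ "c' + e'"]) simp
  qed
qed

section \<open>Monomials in a prime ideal\<close>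

lemma prime_ideal_power:
  assumes "prime_ideal (P :: 'a::idom set)" and "x ^ n \<in> P"
  shows "x \<in> P"
  using assms(2) one_notin_prime[OF assms(1)] assms(1)
  by (induction n) (auto simp: prime_ideal_def)

lemma monom_exp_sum:
  "finite A \<Longrightarrow> monom_exp (\<Sum>a\<in>A. f a) = (\<Prod>a\<in>A. monom_exp (f a) :: ('v, 'k::comm_ring_1) mpol)"
  by (induction A rule: finite_induct) (simp_all add: monom_exp_0 monom_exp_add)

lemma prime_ideal_prod:
  assumes "prime_ideal (P :: 'a::idom set)" and "finite A" and "(\<Prod>a\<in>A. f a) \<in> P"
  shows "\<exists>a\<in>A. f a \<in> P"
  using assms(2,3) one_notin_prime[OF assms(1)] assms(1)
  by (induction A rule: finite_induct) (auto simp: prime_ideal_def)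

lemma monom_exp_single_power:
  "monom_exp (Poly_Mapping.single v n) = (monom_exp (Poly_Mapping.single v 1) ^ n :: ('v, 'k::comm_ring_1) mpol)"
proof (induction n)
  case (Suc n)
  have "Poly_Mapping.single v (Suc n) = Poly_Mapping.single v 1 + Poly_Mapping.single v n"
    by (simp flip: single_add)
  then show ?case by (simp only: monom_exp_add Suc.IH power_Suc)
qed (simp add: monom_exp_0)

text \<open>A prime containing a product of powers of variables contains one of these variables;
  conversely, an ideal absorbs multiples.\<close>

lemma monom_exp_in_prime_iff:
  fixes P :: "('v::linorder, 'k::field) mpol set"
  assumes P: "prime_ideal P"
  shows "monom_exp b \<in> P \<longleftrightarrow> (\<exists>v\<in>vars_in P. Poly_Mapping.lookup b v \<noteq> 0)"
proof
  have eq: "b = (\<Sum>v\<in>Poly_Mapping.keys b. Poly_Mapping.single v (Poly_Mapping.lookup b v))"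
    by (rule poly_mapping_expand)
  assume "monom_exp b \<in> P"
  then have "(\<Prod>v\<in>Poly_Mapping.keys b. monom_exp (Poly_Mapping.single v (Poly_Mapping.lookup b v))) \<in> P"
    by (subst (asm) eq) (simp add: monom_exp_sum)
  then obtain v where v: "v \<in> Poly_Mapping.keys b"
    "monom_exp (Poly_Mapping.single v (Poly_Mapping.lookup b v)) \<in> P"
    using prime_ideal_prod[OF P finite_keys] by blast
  then have "monom_exp (Poly_Mapping.single v 1) \<in> P"
    using prime_ideal_power[OF P] monom_exp_single_power by metis
  then show "\<exists>v\<in>vars_in P. Poly_Mapping.lookup b v \<noteq> 0"
    using v(1) by (auto simp: vars_in_def in_keys_iff)
next
  assume "\<exists>v\<in>vars_in P. Poly_Mapping.lookup b v \<noteq> 0"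
  then obtain v where v: "monom_exp (Poly_Mapping.single v 1) \<in> P" "Poly_Mapping.lookup b v \<noteq> 0"
    by (auto simp: vars_in_def)
  have "b = (b - Poly_Mapping.single v 1) + Poly_Mapping.single v 1"
    using v(2) by (intro poly_mapping_eqI) (auto simp: lookup_add lookup_minus lookup_single when_def)
  then have "monom_exp b = monom_exp (b - Poly_Mapping.single v 1) * (monom_exp (Poly_Mapping.single v 1) :: ('v, 'k) mpol)"
    by (metis monom_exp_add)
  then show "monom_exp b \<in> P"
    using v(1) P ideal_mult by (metis prime_ideal_def)
qed

section \<open>Multipliers outside a prime, and the contraction of monomial ideals\<close>

definition deg_in :: "'v set \<Rightarrow> ('v \<Rightarrow>\<^sub>0 nat) \<Rightarrow> nat" where
  "deg_in S a = (\<Sum>v\<in>S. Poly_Mapping.lookup a v)"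

lemma deg_in_add: "deg_in S (a + b) = deg_in S a + deg_in S b"
  by (simp add: deg_in_def lookup_add sum.distrib)

lemma deg_in_eq_0_iff:
  "deg_in S a = 0 \<longleftrightarrow> (\<forall>v\<in>S. Poly_Mapping.lookup a v = 0)" if "finite S"
  using that by (simp add: deg_in_def)

text \<open>Degree in \<open>S\<close> is additive, so products with a term of \<open>s\<close>
  involving \<open>S\<close>, or with a term of \<open>f\<close> of degree above \<open>d\<close>,
  have degree above \<open>d\<close>.\<close>

lemma lowest_part_mult:
  fixes s f :: "('v, 'k::comm_ring_1) mpol"
  assumes "\<And>a. a \<in> Poly_Mapping.keys f \<Longrightarrow> d \<le> deg_in S a" and "deg_in S c = d"
  shows "Poly_Mapping.lookup (s * f) c =
    Poly_Mapping.lookup (restr {a. deg_in S a = 0} s * restr {a. deg_in S a = d} f) c"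
proof -
  define s0 s1 where "s0 = restr {a. deg_in S a = 0} s" and "s1 = restr (- {a. deg_in S a = 0}) s"
  define f0 f1 where "f0 = restr {a. deg_in S a = d} f" and "f1 = restr (- {a. deg_in S a = d}) f"
  have s: "s = s0 + s1" and f: "f = f0 + f1"
    by (simp_all add: s0_def s1_def f0_def f1_def restr_compl)
  have "s * f = s0 * f + s1 * f" by (simp add: s distrib_right)
  also have "s0 * f = s0 * f0 + s0 * f1" by (simp add: f distrib_left)
  finally have "s * f = s0 * f0 + (s1 * f + s0 * f1)" by (simp add: ac_simps)
  moreover have "c \<notin> Poly_Mapping.keys (s1 * f)"
  proof
    assume "c \<in> Poly_Mapping.keys (s1 * f)"
    then obtain a b where "c = a + b" "a \<in> Poly_Mapping.keys s1" "b \<in> Poly_Mapping.keys f"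
      using Poly_Mapping.keys_mult[of s1 f] by auto
    then show False using assms(1)[of b] assms(2) by (auto simp: s1_def deg_in_add)
  qed
  moreover have "c \<notin> Poly_Mapping.keys (s0 * f1)"
  proof
    assume "c \<in> Poly_Mapping.keys (s0 * f1)"
    then obtain a b where "c = a + b" "a \<in> Poly_Mapping.keys s0" "b \<in> Poly_Mapping.keys f1"
      using Poly_Mapping.keys_mult[of s0 f1] by auto
    then show False using assms(1)[of b] assms(2) by (auto simp: f1_def s0_def deg_in_add)
  qed
  ultimately show ?thesis
    by (simp add: lookup_add in_keys_iff s0_def f0_def)
qed

text \<open>
  Among the terms of \<open>f\<close> outside \<open>sat S U\<close>, those of lowest degree in \<open>S\<close> get multiplied by the
  part of \<open>s\<close> free of \<open>S\<close>, with no cancellation against other terms; the product is nonzero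
  because the ring is a domain.
\<close>

lemma mult_in_poly_supp_imp_sat:
  fixes s f :: "('v::{finite,linorder}, 'k::field) mpol"
  assumes U: "upset U" and b: "b \<in> Poly_Mapping.keys s" "\<forall>v\<in>S. Poly_Mapping.lookup b v = 0"
    and sf: "s * f \<in> poly_supp U"
  shows "f \<in> poly_supp (sat S U)"
proof (rule ccontr)
  let ?W = "sat S U"
  assume f: "f \<notin> poly_supp ?W"
  define f0 where "f0 = restr (- ?W) f"
  have ideal: "is_ideal (poly_supp ?W :: ('v, 'k) mpol set)"
    by (intro is_ideal_poly_supp upset_sat U)
  have "s * restr ?W f \<in> poly_supp ?W"
    by (intro ideal_mult[OF ideal]) (simp add: poly_supp_def)
  moreover have "s * f \<in> poly_supp ?W" using sf subset_sat[of U S] by (auto simp: poly_supp_def)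
  ultimately have "s * f - s * restr ?W f \<in> poly_supp ?W" by (rule ideal_diff[OF ideal, rotated])
  also have "s * f - s * restr ?W f = s * f0"
    by (subst restr_compl[of ?W f, symmetric]) (simp add: f0_def algebra_simps)
  finally have sf0: "Poly_Mapping.keys (s * f0) \<subseteq> ?W" by (simp add: poly_supp_def)
  have ne: "Poly_Mapping.keys f0 \<noteq> {}" using f by (auto simp: f0_def poly_supp_def)
  define d where "d = Min (deg_in S ` Poly_Mapping.keys f0)"
  have d: "d \<le> deg_in S a" if "a \<in> Poly_Mapping.keys f0" for a
    unfolding d_def using that by simp
  have "d \<in> deg_in S ` Poly_Mapping.keys f0" unfolding d_def using ne by (intro Min_in) auto
  then obtain a0 where a0: "a0 \<in> Poly_Mapping.keys f0" "deg_in S a0 = d" by auto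
  let ?s = "restr {a. deg_in S a = 0} s" and ?f = "restr {a. deg_in S a = d} f0"
  have "b \<in> Poly_Mapping.keys ?s" using b by (simp add: deg_in_eq_0_iff)
  moreover have "a0 \<in> Poly_Mapping.keys ?f" using a0 by simp
  ultimately have "?s * ?f \<noteq> 0" by (metis keys_zero empty_iff mult_eq_0_iff)
  then obtain c where c: "c \<in> Poly_Mapping.keys (?s * ?f)" by (metis keys_eq_empty equals0I)
  then obtain b' a where c_eq: "c = b' + a" and b': "deg_in S b' = 0"
    and a: "a \<in> Poly_Mapping.keys f0" "deg_in S a = d"
    using Poly_Mapping.keys_mult[of ?s ?f] by auto
  have "Poly_Mapping.lookup (s * f0) c = Poly_Mapping.lookup (?s * ?f) c"
    by (rule lowest_part_mult[OF d]) (simp_all add: c_eq deg_in_add b' a)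
  with c have "c \<in> Poly_Mapping.keys (s * f0)" by (simp add: in_keys_iff)
  with sf0 have "c \<in> ?W" by auto
  then obtain e where "\<forall>v\<in>S. Poly_Mapping.lookup e v = 0" "b' + a + e \<in> U"
    by (auto simp: sat_def c_eq)
  \<comment> \<open>\<open>b'\<close> is free of \<open>S\<close>, so it joins \<open>e\<close> in
    witnessing that \<open>a\<close> lies in the saturation.\<close>
  then have "a \<in> ?W" using b' unfolding sat_def
    by (intro CollectI exI[of _ "b' + e"]) (auto simp: deg_in_eq_0_iff lookup_add ac_simps)
  with a(1) show False by (simp add: f0_def)
qed

lemma colon_prime_iff:
  fixes P :: "('v::{finite,linorder}, 'k::field) mpol set"
  assumes P: "prime_ideal P" and U: "upset U"
  shows "(\<exists>s. s \<notin> P \<and> s * f \<in> poly_supp U) \<longleftrightarrow> f \<in> poly_supp (sat (vars_in P) U)"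
proof
  let ?S = "vars_in P"
  assume "\<exists>s. s \<notin> P \<and> s * f \<in> poly_supp U"
  then obtain s where s: "s \<notin> P" "s * f \<in> poly_supp U" by auto
  obtain b where b: "b \<in> Poly_Mapping.keys s" "monom_exp b \<notin> P"
  proof (rule ccontr)
    assume "\<not> thesis"
    then have "\<And>b. b \<in> Poly_Mapping.keys s \<Longrightarrow> monom_exp b \<in> P" using that by blast
    then have "poly_supp (Poly_Mapping.keys s) \<subseteq> P"
      using P by (intro poly_supp_subset_ideal) (auto simp: prime_ideal_def)
    then show False using s(1) by (auto simp: poly_supp_def)
  qed
  show "f \<in> poly_supp (sat ?S U)"
    by (rule mult_in_poly_supp_imp_sat[OF U b(1) _ s(2)])
       (use b(2) in \<open>simp add: monom_exp_in_prime_iff[OF P]\<close>)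
next
  let ?S = "vars_in P"
  assume "f \<in> poly_supp (sat ?S U)"
  then have "\<forall>a\<in>Poly_Mapping.keys f. \<exists>b. (\<forall>v\<in>?S. Poly_Mapping.lookup b v = 0) \<and> a + b \<in> U"
    by (auto simp: poly_supp_def sat_def)
  then obtain b where b: "\<And>a. a \<in> Poly_Mapping.keys f \<Longrightarrow> \<forall>v\<in>?S. Poly_Mapping.lookup (b a) v = 0"
    "\<And>a. a \<in> Poly_Mapping.keys f \<Longrightarrow> a + b a \<in> U" by metis
  \<comment> \<open>One multiplier for all terms of \<open>f\<close>: the sum of the individual
    exponents still avoids the variables in \<open>P\<close>.\<close>
  define e where "e = (\<Sum>a\<in>Poly_Mapping.keys f. b a)"
  have "e + a \<in> U" if "a \<in> Poly_Mapping.keys f" for a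
  proof -
    have "e = b a + (\<Sum>a'\<in>Poly_Mapping.keys f - {a}. b a')"
      unfolding e_def using that by (simp add: sum.remove)
    then have "e + a = (a + b a) + (\<Sum>a'\<in>Poly_Mapping.keys f - {a}. b a')" by (simp add: ac_simps)
    then show ?thesis using U b(2)[OF that] by (simp only: upset_def)
  qed
  then have "monom_exp e * f \<in> poly_supp U"
    using Poly_Mapping.keys_mult[of "monom_exp e" f] by (auto simp: poly_supp_def)
  moreover have "monom_exp e \<notin> P"
    using b(1) by (auto simp: monom_exp_in_prime_iff[OF P] e_def lookup_sum)
  ultimately show "\<exists>s. s \<notin> P \<and> s * f \<in> poly_supp U" by blast
qed

lemma contracted_local_poly_supp:
  fixes P :: "('v::{finite,linorder}, 'k::field) mpol set"
  assumes "prime_ideal P" and "upset U"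
  shows "contracted_local (poly_supp U) P = poly_supp (sat (vars_in P) U)"
  using to_fract_in_extended_ideal_iff[OF assms(1) is_ideal_poly_supp[OF assms(2)]]
    colon_prime_iff[OF assms]
  by (auto simp: contracted_local_def)

lemma symbolic_power_poly_supp:
  fixes U :: "('v::{finite,linorder} \<Rightarrow>\<^sub>0 nat) set"
  assumes U: "upset U"
  shows "symbolic_power (poly_supp U :: ('v, 'k::field) mpol set) m =
    poly_supp (\<Inter>P\<in>Ass (poly_supp U :: ('v, 'k) mpol set). msum (sat (vars_in P) U) m)"
    (is "?L = ?R")
proof -
  have "to_fract f \<in> extended_ideal (poly_supp (msum U m)) P
      \<longleftrightarrow> f \<in> poly_supp (msum (sat (vars_in P) U) m)"
    if "P \<in> Ass (poly_supp U)" for f and P :: "('v, 'k) mpol set"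
  proof -
    have P: "prime_ideal P" using that by (simp add: Ass_def)
    show ?thesis
      using to_fract_in_extended_ideal_iff[OF P is_ideal_poly_supp[OF upset_msum[OF U]]]
        colon_prime_iff[OF P upset_msum[OF U]] by (simp add: sat_msum[OF U])
  qed
  then have "f \<in> ?L \<longleftrightarrow> (\<forall>P\<in>Ass (poly_supp U :: ('v, 'k) mpol set).
      f \<in> poly_supp (msum (sat (vars_in P) U) m))" for f
    by (simp add: symbolic_power_def ideal_power_poly_supp[OF U])
  then show ?thesis by (auto simp: poly_supp_def)
qed

subsection \<open>Associated primes\<close>

text \<open>The ideal generated by the variables in \<open>S\<close>.\<close>

definition var_prime :: "'v set \<Rightarrow> ('v, 'k::comm_ring_1) mpol set" where
  "var_prime S = poly_supp {a. \<exists>v\<in>S. Poly_Mapping.lookup a v \<noteq> 0}"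

text \<open>Modulo this ideal only the terms free of \<open>S\<close> matter; a product of two
  nonzero such parts is nonzero and again free of \<open>S\<close>.\<close>

lemma prime_ideal_var_prime:
  fixes S :: "'v::linorder set"
  shows "prime_ideal (var_prime S :: ('v, 'k::field) mpol set)"
proof -
  let ?P = "var_prime S :: ('v, 'k) mpol set"
  define U :: "('v \<Rightarrow>\<^sub>0 nat) set" where "U = {a. \<exists>v\<in>S. Poly_Mapping.lookup a v \<noteq> 0}"
  have U: "upset U" by (auto simp: upset_def U_def lookup_add)
  have P: "?P = poly_supp U" by (simp add: var_prime_def U_def)
  have ideal: "is_ideal ?P" unfolding P by (rule is_ideal_poly_supp[OF U])
  have "(1 :: ('v, 'k) mpol) \<notin> ?P" by (auto simp: P U_def poly_supp_def)
  then have "?P \<noteq> UNIV" by auto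
  moreover have "f \<in> ?P \<or> g \<in> ?P" if fg: "f * g \<in> ?P" for f g
  proof (rule ccontr)
    assume nin: "\<not> (f \<in> ?P \<or> g \<in> ?P)"
    let ?f = "restr (- U) f" and ?g = "restr (- U) g"
    have "f * g = ?f * ?g + (restr U f * g + ?f * restr U g)"
      by (subst (1) restr_compl[of U f, symmetric], subst (1 3) restr_compl[of U g, symmetric])
         (simp add: algebra_simps)
    moreover have "restr U f * g + ?f * restr U g \<in> ?P"
      by (subst mult.commute, intro ideal_add[OF ideal] ideal_mult[OF ideal])
         (simp_all add: P poly_supp_def)
    ultimately have "?f * ?g \<in> ?P"
      using ideal_diff[OF ideal fg] by (metis add_diff_cancel_right')
    moreover have "Poly_Mapping.keys (?f * ?g) \<subseteq> - U"
      using Poly_Mapping.keys_mult[of ?f ?g] by (force simp: U_def lookup_add)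
    ultimately have "Poly_Mapping.keys (?f * ?g) = {}" unfolding P poly_supp_def by blast
    then have "?f = 0 \<or> ?g = 0" by (simp only: keys_eq_empty mult_eq_0_iff)
    then have "Poly_Mapping.keys ?f = {} \<or> Poly_Mapping.keys ?g = {}" by (metis keys_zero)
    with nin show False by (auto simp: P poly_supp_def)
  qed
  ultimately show ?thesis using ideal by (auto simp: prime_ideal_def)
qed

text \<open>
  If \<open>x\<^sup>a \<notin> I\<close> is chosen such that as many variables as possible multiply it into \<open>I\<close>, then
  \<open>(I : x\<^sup>a)\<close> is generated by these variables.
\<close>

lemma Ass_nonempty:
  fixes U :: "('v::{finite,linorder} \<Rightarrow>\<^sub>0 nat) set"
  assumes U: "upset U" and "0 \<notin> U"
  shows "Ass (poly_supp U :: ('v, 'k::field) mpol set) \<noteq> {}"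
proof -
  define N where "N a = {v. a + Poly_Mapping.single v 1 \<in> U}" for a
  \<comment> \<open>The count is bounded by the number of variables and 0 lies outside
    \<open>U\<close>, so a maximum exists.\<close>
  have "\<exists>a. a \<notin> U \<and> (\<forall>b. b \<notin> U \<longrightarrow> card (N b) \<le> card (N a))"
    by (rule ex_has_greatest_nat[of "\<lambda>a. a \<notin> U" 0 _ "Suc CARD('v)"])
       (use assms(2) in \<open>auto simp: less_Suc_eq_le intro: card_mono\<close>)
  then obtain a where a: "a \<notin> U" and max: "\<And>b. b \<notin> U \<Longrightarrow> card (N b) \<le> card (N a)"
    by blast
  \<comment> \<open>Moving up from \<open>a\<close> can only enlarge \<open>N\<close>, so maximality
    forces equality while \<open>U\<close> is not reached.\<close>
  have N_eq: "N (a + b) = N a" if "a + b \<notin> U" for b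
  proof -
    have "N a \<subseteq> N (a + b)"
    proof
      fix v assume "v \<in> N a"
      then have "(a + Poly_Mapping.single v 1) + b \<in> U" using U by (simp add: upset_def N_def)
      moreover have "(a + Poly_Mapping.single v 1) + b = (a + b) + Poly_Mapping.single v 1"
        by (simp only: ac_simps)
      ultimately show "v \<in> N (a + b)" unfolding N_def by (metis mem_Collect_eq)
    qed
    then show ?thesis using max[OF that] by (intro card_subset_eq[symmetric]) (auto simp: card_mono le_antisym)
  qed
  \<comment> \<open>Build \<open>b\<close> one variable at a time: by \<open>N_eq\<close>, a
    variable outside \<open>N a\<close> never takes the exponent into \<open>U\<close>.\<close>
  have off: "a + b \<notin> U" if "\<forall>v\<in>N a. Poly_Mapping.lookup b v = 0" for b
    using that
  proof (induction "deg_in UNIV b" arbitrary: b)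
    case 0
    then have "b = 0" by (intro poly_mapping_eqI) (simp add: deg_in_eq_0_iff)
    then show ?case using a by simp
  next
    case (Suc n)
    then obtain v where v: "Poly_Mapping.lookup b v \<noteq> 0"
      by (metis deg_in_eq_0_iff finite nat.distinct(1))
    define c where "c = b - Poly_Mapping.single v 1"
    have b: "b = c + Poly_Mapping.single v 1" unfolding c_def
      using v by (intro poly_mapping_eqI) (auto simp: lookup_add lookup_minus lookup_single when_def)
    have "deg_in UNIV (Poly_Mapping.single v 1) = 1"
      by (simp add: deg_in_def lookup_single when_def)
    then have "n = deg_in UNIV c" using Suc(2) by (simp add: b deg_in_add)
    moreover have "\<forall>v\<in>N a. Poly_Mapping.lookup c v = 0"
      using Suc.prems by (simp add: c_def lookup_minus)
    ultimately have "a + c \<notin> U" using Suc.hyps(1) by blast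
    moreover have "v \<notin> N (a + c)" using N_eq[OF calculation] Suc.prems v by auto
    ultimately show ?case by (simp add: N_def b add.assoc)
  qed
  have "a + b \<in> U \<longleftrightarrow> (\<exists>v\<in>N a. Poly_Mapping.lookup b v \<noteq> 0)" for b
  proof
    assume "\<exists>v\<in>N a. Poly_Mapping.lookup b v \<noteq> 0"
    then obtain v where v: "a + Poly_Mapping.single v 1 \<in> U" "Poly_Mapping.lookup b v \<noteq> 0"
      by (auto simp: N_def)
    have "b = Poly_Mapping.single v 1 + (b - Poly_Mapping.single v 1)"
      using v by (intro poly_mapping_eqI) (auto simp: lookup_add lookup_minus lookup_single when_def)
    then show "a + b \<in> U" using U v(1) by (metis add.assoc upset_def)
  qed (use off in blast)
  moreover have "Poly_Mapping.keys (g * monom_exp a) = (+) a ` Poly_Mapping.keys g" for g :: "('v, 'k) mpol"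
  proof -
    have eq: "g * monom_exp a = (\<Sum>b\<in>Poly_Mapping.keys g. Poly_Mapping.single (a + b) (Poly_Mapping.lookup g b))"
      by (subst poly_mapping_expand) (simp add: monom_exp_def sum_distrib_right mult_single add.commute)
    have "Poly_Mapping.lookup (g * monom_exp a) (a + b) = Poly_Mapping.lookup g b" for b
      by (simp add: eq lookup_sum lookup_single when_def sum.delta in_keys_iff)
    then have "(+) a ` Poly_Mapping.keys g \<subseteq> Poly_Mapping.keys (g * monom_exp a)"
      by (auto simp: in_keys_iff)
    moreover have "Poly_Mapping.keys (g * monom_exp a) \<subseteq> (+) a ` Poly_Mapping.keys g"
      using Poly_Mapping.keys_mult[of g "monom_exp a"] by (auto simp: add.commute)
    ultimately show ?thesis by blast
  qed
  ultimately have "var_prime (N a) = {g. g * monom_exp a \<in> (poly_supp U :: ('v, 'k) mpol set)}"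
    by (auto simp: var_prime_def poly_supp_def)
  then show ?thesis using prime_ideal_var_prime[where 'k='k, of "N a"] unfolding Ass_def by blast
qed

section \<open>Associated primes are generated by variables\<close>

lemma Max_keys_add_in_keys_mult:
  fixes f g :: "('v::linorder, 'k::field) mpol"
  assumes "f \<noteq> 0" "g \<noteq> 0"
  shows "Max (Poly_Mapping.keys g) + Max (Poly_Mapping.keys f) \<in> Poly_Mapping.keys (g * f)"
proof -
  define t where "t = Max (Poly_Mapping.keys g)"
  define u where "u = Max (Poly_Mapping.keys f)"
  have t: "t \<in> Poly_Mapping.keys g" "\<And>a. a \<in> Poly_Mapping.keys g \<Longrightarrow> a \<le> t"
    using assms by (auto simp: t_def intro!: Max_in)
  have u: "u \<in> Poly_Mapping.keys f" "\<And>a. a \<in> Poly_Mapping.keys f \<Longrightarrow> a \<le> u"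
    using assms by (auto simp: u_def intro!: Max_in)
  have t0: "restr {t} g = Poly_Mapping.single t (Poly_Mapping.lookup g t)"
    and u0: "restr {u} f = Poly_Mapping.single u (Poly_Mapping.lookup f u)"
    by (auto intro!: poly_mapping_eqI simp: lookup_restr lookup_single when_def)
  \<comment> \<open>The order on exponents is compatible with addition, so only the pair of leading
    terms contributes to \<open>t + u\<close>.\<close>
  have "g * f = restr {t} g * restr {u} f + (restr (- {t}) g * f + restr {t} g * restr (- {u}) f)"
    by (subst (1) restr_compl[of "{t}" g, symmetric], subst (1 3) restr_compl[of "{u}" f, symmetric])
       (simp add: algebra_simps)
  moreover have "t + u \<notin> Poly_Mapping.keys (restr (- {t}) g * f)"
  proof
    assume "t + u \<in> Poly_Mapping.keys (restr (- {t}) g * f)"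
    then obtain a b where ab: "t + u = a + b" "a \<in> Poly_Mapping.keys g" "a \<noteq> t" "b \<in> Poly_Mapping.keys f"
      using Poly_Mapping.keys_mult[of "restr (- {t}) g" f] by auto
    then have "a < t" "b \<le> u" using t(2)[of a] u(2)[of b] by auto
    then show False using add_less_le_mono[of a t b u] ab(1) by simp
  qed
  moreover have "t + u \<notin> Poly_Mapping.keys (restr {t} g * restr (- {u}) f)"
  proof
    assume "t + u \<in> Poly_Mapping.keys (restr {t} g * restr (- {u}) f)"
    then obtain b where "t + u = t + b" "b \<noteq> u"
      using Poly_Mapping.keys_mult[of "restr {t} g" "restr (- {u}) f"] by auto
    then show False by simp
  qed
  moreover have "Poly_Mapping.lookup (restr {t} g * restr {u} f) (t + u) \<noteq> 0"
    using t(1) u(1) by (simp add: t0 u0 mult_single in_keys_iff)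
  ultimately show ?thesis
    by (simp add: in_keys_iff lookup_add t_def[symmetric] u_def[symmetric])
qed

lemma leading_monom_power_mult:
  fixes f g :: "('v::linorder, 'k::field) mpol"
  assumes U: "upset U" and "g \<noteq> 0" and "g * f \<in> poly_supp U"
  shows "\<exists>N. monom_exp (Max (Poly_Mapping.keys g)) ^ N * f \<in> poly_supp U"
  \<comment> \<open>The leading monomial of \<open>g\<close> multiplies that of \<open>f\<close> into the ideal, so after multiplying by it,
    the leading term of \<open>f\<close> can be dropped.\<close>
  using assms(3)
proof (induction "card (Poly_Mapping.keys f)" arbitrary: f rule: less_induct)
  case less
  show ?case
  proof (cases "f = 0")
    case True
    then show ?thesis by (auto simp: poly_supp_def)
  next
    case False
    define t where "t = Max (Poly_Mapping.keys g)"
    define u where "u = Max (Poly_Mapping.keys f)"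
    have ideal: "is_ideal (poly_supp U :: ('v, 'k) mpol set)" by (rule is_ideal_poly_supp[OF U])
    have u: "u \<in> Poly_Mapping.keys f" using False by (auto simp: u_def intro!: Max_in)
    have "t + u \<in> U"
      using Max_keys_add_in_keys_mult[OF False assms(2)] less.prems by (auto simp: poly_supp_def t_def u_def)
    moreover have "Poly_Mapping.keys (monom_exp t * restr {u} f) \<subseteq> {t + u}"
      using Poly_Mapping.keys_mult[of "monom_exp t" "restr {u} f"] by auto
    ultimately have tu: "monom_exp t * restr {u} f \<in> poly_supp U" by (auto simp: poly_supp_def)
    define f' where "f' = monom_exp t * restr (- {u}) f"
    have f'_eq: "f' = monom_exp t * f - monom_exp t * restr {u} f"
      unfolding f'_def by (subst (2) restr_compl[of "{u}" f, symmetric]) (simp add: algebra_simps)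
    have "g * f' = monom_exp t * (g * f) - g * (monom_exp t * restr {u} f)"
      by (simp add: f'_eq algebra_simps)
    then have "g * f' \<in> poly_supp U"
      using ideal_diff[OF ideal] ideal_mult[OF ideal] less.prems tu by metis
    \<comment> \<open>Translation creates no terms and the leading one is gone, so \<open>f'\<close>
      has fewer terms than \<open>f\<close>.\<close>
    moreover have "Poly_Mapping.keys f' \<subseteq> (+) t ` (Poly_Mapping.keys f - {u})"
      using Poly_Mapping.keys_mult[of "monom_exp t" "restr (- {u}) f"] by (auto simp: f'_def)
    then have "card (Poly_Mapping.keys f') \<le> card (Poly_Mapping.keys f - {u})"
      by (meson card_image_le card_mono finite_Diff finite_imageI finite_keys le_trans)
    then have "card (Poly_Mapping.keys f') < card (Poly_Mapping.keys f)"
      using u by (meson card_Diff1_less finite_keys le_less_trans)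
    ultimately obtain N where N: "monom_exp t ^ N * f' \<in> poly_supp U"
      using less.hyps unfolding t_def by blast
    have "monom_exp t ^ Suc N * f = monom_exp t ^ N * f' + monom_exp t ^ N * (monom_exp t * restr {u} f)"
      by (simp add: f'_eq algebra_simps)
    then have "monom_exp t ^ Suc N * f \<in> poly_supp U"
      using ideal_add[OF ideal N] ideal_mult[OF ideal tu] by metis
    then show ?thesis unfolding t_def by blast
  qed
qed

text \<open>\<open>P\<close> is a colon ideal, so by \<open>leading_monom_power_mult\<close> it
  contains a power of the leading monomial of each nonzero member, hence that monomial by primality.
  Removing leading terms in turn puts all monomials into \<open>P\<close>.\<close>

lemma Ass_eq_var_prime:
  fixes U :: "('v::linorder \<Rightarrow>\<^sub>0 nat) set" and P :: "('v, 'k::field) mpol set"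
  assumes U: "upset U" and "P \<in> Ass (poly_supp U)"
  shows "P = var_prime (vars_in P)"
proof -
  obtain f where f: "P = {g. g * f \<in> poly_supp U}" and P: "prime_ideal P"
    using assms(2) by (auto simp: Ass_def)
  have ideal: "is_ideal P" using P by (simp add: prime_ideal_def)
  have mono: "monom_exp a \<in> P" if "g \<in> P" "a \<in> Poly_Mapping.keys g" for a g
    using that
  proof (induction "card (Poly_Mapping.keys g)" arbitrary: g rule: less_induct)
    case less
    define t where "t = Max (Poly_Mapping.keys g)"
    have "g \<noteq> 0" using less.prems by auto
    then have t: "t \<in> Poly_Mapping.keys g" by (auto simp: t_def intro!: Max_in)
    obtain N where "monom_exp t ^ N * f \<in> poly_supp U"
      using leading_monom_power_mult[OF U \<open>g \<noteq> 0\<close>] less.prems f unfolding t_def by blast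
    then have tP: "monom_exp t \<in> P" using f prime_ideal_power[OF P] by blast
    show ?case
    proof (cases "a = t")
      case False
      have "restr {t} g = Poly_Mapping.single 0 (Poly_Mapping.lookup g t) * monom_exp t"
        by (intro poly_mapping_eqI) (auto simp: monom_exp_def mult_single lookup_restr lookup_single when_def)
      then have "restr {t} g \<in> P" using ideal_mult[OF ideal tP] by metis
      moreover have "restr (- {t}) g = g - restr {t} g"
        by (metis add_diff_cancel_left' restr_compl)
      ultimately have "restr (- {t}) g \<in> P" using ideal_diff[OF ideal less.prems(1)] by metis
      moreover have "card (Poly_Mapping.keys (restr (- {t}) g)) < card (Poly_Mapping.keys g)"
        using t by (intro psubset_card_mono) auto
      moreover have "a \<in> Poly_Mapping.keys (restr (- {t}) g)" using less.prems(2) False by simp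
      ultimately show ?thesis using less.hyps by blast
    qed (use tP in simp)
  qed
  show ?thesis
  proof
    show "P \<subseteq> var_prime (vars_in P)"
      using mono monom_exp_in_prime_iff[OF P] by (fastforce simp: var_prime_def poly_supp_def)
    show "var_prime (vars_in P) \<subseteq> P"
      unfolding var_prime_def by (rule poly_supp_subset_ideal[OF ideal]) (simp add: monom_exp_in_prime_iff[OF P])
  qed
qed

section \<open>Reduction to the maximal associated primes\<close>

lemma finite_Ass:
  fixes U :: "('v::{finite,linorder} \<Rightarrow>\<^sub>0 nat) set"
  assumes "upset U"
  shows "finite (Ass (poly_supp U :: ('v, 'k::field) mpol set))"
proof (rule finite_subset)
  show "Ass (poly_supp U :: ('v, 'k) mpol set) \<subseteq> range var_prime"
    using Ass_eq_var_prime[OF assms] by blast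
qed simp

lemma exists_maxAss_above:
  fixes U :: "('v::{finite,linorder} \<Rightarrow>\<^sub>0 nat) set" and P :: "('v, 'k::field) mpol set"
  assumes "upset U" and "P \<in> Ass (poly_supp U)"
  shows "\<exists>P'\<in>maxAss (poly_supp U). P \<subseteq> P'"
  using finite_has_maximal2[OF finite_Ass[OF assms(1)] assms(2)]
  by (auto simp: maxAss_def)

text \<open>A larger prime contains more variables and so inverts fewer, which shrinks the
  saturation; the maximal primes give the smallest sets.\<close>

lemma Inter_Ass_eq_Inter_maxAss:
  fixes U :: "('v::{finite,linorder} \<Rightarrow>\<^sub>0 nat) set"
  assumes U: "upset U"
  shows "(\<Inter>P\<in>Ass (poly_supp U :: ('v, 'k::field) mpol set). msum (sat (vars_in P) U) m) =
    (\<Inter>P\<in>maxAss (poly_supp U :: ('v, 'k) mpol set). msum (sat (vars_in P) U) m)"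
proof
  show "(\<Inter>P\<in>maxAss (poly_supp U :: ('v, 'k) mpol set). msum (sat (vars_in P) U) m)
    \<subseteq> (\<Inter>P\<in>Ass (poly_supp U :: ('v, 'k) mpol set). msum (sat (vars_in P) U) m)"
  proof (rule INT_greatest)
    fix P :: "('v, 'k) mpol set" assume "P \<in> Ass (poly_supp U)"
    then obtain P' where "P' \<in> maxAss (poly_supp U)" "P \<subseteq> P'"
      using exists_maxAss_above[OF U] by blast
    moreover from this have "vars_in P \<subseteq> vars_in P'" by (auto simp: vars_in_def)
    then have "msum (sat (vars_in P') U) m \<subseteq> msum (sat (vars_in P) U) m"
      by (simp only: sat_msum[OF U, symmetric] sat_antimono)
    ultimately show "(\<Inter>P\<in>maxAss (poly_supp U :: ('v, 'k) mpol set). msum (sat (vars_in P) U) m)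
        \<subseteq> msum (sat (vars_in P) U) m" by blast
  qed
qed (auto simp: maxAss_def)

lemma initial_degree_poly_supp:
  "initial_degree (poly_supp V :: ('v::finite, 'k::comm_ring_1) mpol set)
    = (LEAST d. \<exists>a\<in>V. deg_in UNIV a = d)"
proof -
  have "(\<exists>f\<in>(poly_supp V :: ('v, 'k) mpol set). f \<noteq> 0 \<and> homogeneous_of_degree d f)
      \<longleftrightarrow> (\<exists>a\<in>V. deg_in UNIV a = d)" for d
  proof
    assume "\<exists>f\<in>(poly_supp V :: ('v, 'k) mpol set). f \<noteq> 0 \<and> homogeneous_of_degree d f"
    then obtain f :: "('v, 'k) mpol" where f: "f \<in> poly_supp V" "f \<noteq> 0" "homogeneous_of_degree d f" by blast
    then obtain a where "a \<in> Poly_Mapping.keys f" by (metis keys_eq_empty equals0I)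
    then show "\<exists>a\<in>V. deg_in UNIV a = d" using f
      by (auto simp: poly_supp_def homogeneous_of_degree_def deg_in_def)
  next
    assume "\<exists>a\<in>V. deg_in UNIV a = d"
    then obtain a where "a \<in> V" "deg_in UNIV a = d" by blast
    then show "\<exists>f\<in>(poly_supp V :: ('v, 'k) mpol set). f \<noteq> 0 \<and> homogeneous_of_degree d f"
      by (intro bexI[of _ "monom_exp a"])
         (auto simp: homogeneous_of_degree_def deg_in_def simp flip: keys_eq_empty)
  qed
  then show ?thesis by (simp add: initial_degree_def)
qed

subsection \<open>Convex hulls of exponent sets\<close>

definition exp_vec :: "('v::finite \<Rightarrow>\<^sub>0 nat) \<Rightarrow> real ^ 'v" where
  "exp_vec a = (\<chi> i. real (Poly_Mapping.lookup a i))"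

lemma exp_vec_nth [simp]: "exp_vec a $ i = real (Poly_Mapping.lookup a i)"
  by (simp add: exp_vec_def)

lemma exp_vec_add: "exp_vec (a + b) = exp_vec a + exp_vec b"
  by (simp add: vec_eq_iff lookup_add)

lemma lattice_points_poly_supp:
  "lattice_points (poly_supp U :: ('v::finite, 'k::comm_ring_1) mpol set) = exp_vec ` U"
  by (auto simp: lattice_points_def exp_vec_def)

lemma exp_vec_image_plus:
  "exp_vec ` {a + b |a b. a \<in> A \<and> b \<in> B} = exp_vec ` A + exp_vec ` B"
proof
  show "exp_vec ` {a + b |a b. a \<in> A \<and> b \<in> B} \<subseteq> exp_vec ` A + exp_vec ` B"
    by (auto simp: exp_vec_add intro!: set_plus_intro)
  show "exp_vec ` A + exp_vec ` B \<subseteq> exp_vec ` {a + b |a b. a \<in> A \<and> b \<in> B}"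
    unfolding set_plus_def by (clarify, unfold exp_vec_add[symmetric]) blast
qed

text \<open>The hull contains 0 and arbitrarily long multiples of each unit vector, hence the
  coordinate rays, and it is closed under addition.\<close>

lemma convex_hull_range_exp_vec:
  "convex hull range exp_vec = {z :: real ^ 'v::finite. \<forall>i. 0 \<le> z $ i}"
proof
  let ?H = "convex hull range exp_vec :: (real ^ 'v) set"
  have "convex {z :: real ^ 'v. \<forall>i. 0 \<le> z $ i}"
    by (auto simp: convex_def intro: add_nonneg_nonneg)
  then show "?H \<subseteq> {z. \<forall>i. 0 \<le> z $ i}"
    by (intro hull_minimal) auto
  have add: "x + y \<in> ?H" if "x \<in> ?H" "y \<in> ?H" for x y
  proof -
    have "x + y \<in> ?H + ?H" using that by (auto simp: set_plus_def)
    also have "\<dots> = convex hull (range exp_vec + range exp_vec)" by (simp add: convex_hull_set_plus)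
    also have "\<dots> \<subseteq> ?H"
      by (rule hull_mono) (auto simp: set_plus_def simp flip: exp_vec_add)
    finally show ?thesis .
  qed
  have zero: "0 \<in> ?H"
    by (rule hull_inc) (auto simp: image_iff vec_eq_iff intro!: exI[of _ 0])
  have axis: "t *\<^sub>R axis i 1 \<in> ?H" if t: "0 \<le> t" for t i
  proof -
    obtain n :: nat where n: "t < real n" using reals_Archimedean2 by blast
    have "real n *\<^sub>R axis i 1 = exp_vec (Poly_Mapping.single i n)"
      by (auto simp: vec_eq_iff axis_def lookup_single when_def)
    then have "real n *\<^sub>R axis i 1 \<in> ?H" by (auto intro: hull_inc)
    then have "(1 - t / real n) *\<^sub>R 0 + (t / real n) *\<^sub>R (real n *\<^sub>R axis i 1) \<in> ?H"
      using n t zero by (intro convexD_alt convex_convex_hull) auto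
    then show ?thesis using n t by simp
  qed
  show "{z. \<forall>i. 0 \<le> z $ i} \<subseteq> ?H"
  proof
    fix z :: "real ^ 'v" assume z: "z \<in> {z. \<forall>i. 0 \<le> z $ i}"
    have "(\<Sum>i\<in>A. z $ i *\<^sub>R axis i 1) \<in> ?H" if "finite A" for A
      using that by (induction A rule: finite_induct) (use z zero axis add in auto)
    from this[of UNIV] show "z \<in> ?H"
      by (simp add: basis_expansion flip: scalar_mult_eq_scaleR)
  qed
qed

section \<open>Dickson's lemma and closedness of the hulls\<close>

lemma nat_seq_incseq_subseq:
  fixes s :: "nat \<Rightarrow> nat"
  shows "\<exists>r. strict_mono r \<and> incseq (\<lambda>n. s (r n))"
proof -
  obtain f where f: "strict_mono f" "monoseq (\<lambda>n. s (f n))" using seq_monosub[of s] by auto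
  show ?thesis
  proof (cases "incseq (\<lambda>n. s (f n))")
    case False
    then have dec: "decseq (\<lambda>n. s (f n))" using f(2) by (simp add: monoseq_iff)
    \<comment> \<open>A nonincreasing sequence is constant from the index \<open>k\<close> of its
      least value on.\<close>
    define k where "k = (ARG_MIN (\<lambda>n. s (f n)) n. True)"
    have min: "s (f k) \<le> s (f n)" for n unfolding k_def by (rule arg_min_nat_le) simp
    have "s (f (n + k)) = s (f k)" for n
      using min[of "n + k"] dec by (simp add: decseq_def le_antisym)
    then show ?thesis
      using f(1) by (intro exI[of _ "\<lambda>n. f (n + k)"]) (simp add: strict_mono_def)
  qed (use f in blast)
qed

lemma dickson_subseq:
  fixes f :: "nat \<Rightarrow> 'v::finite \<Rightarrow>\<^sub>0 nat"
  shows "\<exists>r. strict_mono r \<and> (\<forall>v. incseq (\<lambda>n. Poly_Mapping.lookup (f (r n)) v))"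
proof -
  \<comment> \<open>Thin out for one coordinate at a time; monotonicity already reached survives
    passing to a subsequence.\<close>
  have "\<exists>r. strict_mono r \<and> (\<forall>v\<in>S. incseq (\<lambda>n. Poly_Mapping.lookup (f (r n)) v))"
    if "finite S" for S
    using that
  proof (induction S rule: finite_induct)
    case empty
    then show ?case by (auto intro: strict_mono_id[unfolded id_def])
  next
    case (insert v S)
    then obtain r where r: "strict_mono r" "\<forall>v\<in>S. incseq (\<lambda>n. Poly_Mapping.lookup (f (r n)) v)" by auto
    obtain r' where r': "strict_mono r'" "incseq (\<lambda>n. Poly_Mapping.lookup (f (r (r' n))) v)"
      using nat_seq_incseq_subseq[of "\<lambda>n. Poly_Mapping.lookup (f (r n)) v"] by auto
    have "incseq (\<lambda>n. Poly_Mapping.lookup (f (r (r' n))) u)" if "u \<in> S" for u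
      using r(2) that r'(1) by (auto simp: incseq_def strict_mono_less_eq)
    then show ?case using r r' by (intro exI[of _ "r \<circ> r'"]) (auto simp: strict_mono_def)
  qed
  from this[of UNIV] show ?thesis by simp
qed

text \<open>The generators are the minimal elements: distinct ones are incomparable, while
  infinitely many would yield a comparable pair by \<open>dickson_subseq\<close>. The conjunct
  \<open>b \<in> UNIV\<close> gives the shape of \<open>exp_vec_image_plus\<close>.\<close>

lemma upset_finitely_generated:
  fixes W :: "('v::finite \<Rightarrow>\<^sub>0 nat) set"
  assumes W: "upset W"
  obtains F where "finite F" and "W = {a + b |a b. a \<in> F \<and> b \<in> UNIV}"
proof -
  define le where "le a b \<longleftrightarrow> (\<forall>v. Poly_Mapping.lookup a v \<le> Poly_Mapping.lookup b v)"
    for a b :: "'v \<Rightarrow>\<^sub>0 nat"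
  define M where "M = {a \<in> W. \<forall>b\<in>W. le b a \<longrightarrow> b = a}"
  have le_add: "b = a + (b - a)" if "le a b" for a b
    using that by (intro poly_mapping_eqI) (simp add: le_def lookup_add lookup_minus)
  have "finite M"
  proof (rule ccontr)
    assume "infinite M"
    then obtain f :: "nat \<Rightarrow> _" where f: "inj f" "range f \<subseteq> M"
      using infinite_countable_subset by blast
    obtain r where r: "strict_mono r" "\<forall>v. incseq (\<lambda>n. Poly_Mapping.lookup (f (r n)) v)"
      using dickson_subseq by blast
    then have "le (f (r 0)) (f (r 1))" by (simp add: le_def incseq_def)
    moreover have "f (r 0) \<in> M" "f (r 1) \<in> M" using f(2) by auto
    ultimately have "f (r 0) = f (r 1)" unfolding M_def by blast
    then show False using f(1) r(1) by (metis injD strict_mono_eq zero_neq_one)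
  qed
  moreover have "\<exists>a\<in>M. le a w" if "w \<in> W" for w
    using that
  proof (induction "deg_in UNIV w" arbitrary: w rule: less_induct)
    case less
    show ?case
    proof (cases "w \<in> M")
      case True
      then show ?thesis by (auto simp: le_def)
    next
      case False
      then obtain b where b: "b \<in> W" "le b w" "b \<noteq> w" using less.prems by (auto simp: M_def)
      have "w - b \<noteq> 0" using le_add[OF b(2)] b(3) by auto
      then have "deg_in UNIV (w - b) \<noteq> 0"
        by (auto simp: deg_in_eq_0_iff intro: poly_mapping_eqI)
      then have "deg_in UNIV b < deg_in UNIV w"
        by (subst le_add[OF b(2)]) (simp add: deg_in_add)
      then obtain a where "a \<in> M" "le a b" using less.hyps b(1) by blast
      then show ?thesis using b(2) unfolding le_def by (meson le_trans)
    qed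
  qed
  then have "W = {a + b |a b. a \<in> M \<and> b \<in> UNIV}"
    using le_add W by (auto simp: M_def upset_def) metis
  ultimately show thesis using that by blast
qed

text \<open>The hull is a polytope plus the nonnegative orthant, so a compact set plus a closed
  one.\<close>

lemma closed_convex_hull_upset:
  fixes W :: "('v::finite \<Rightarrow>\<^sub>0 nat) set"
  assumes "upset W"
  shows "closed (convex hull (exp_vec ` W))"
proof -
  obtain F where F: "finite F" "W = {a + b |a b. a \<in> F \<and> b \<in> UNIV}"
    using upset_finitely_generated[OF assms] .
  have "convex hull (exp_vec ` W) = convex hull (exp_vec ` F) + convex hull range exp_vec"
    unfolding F(2) exp_vec_image_plus convex_hull_set_plus ..
  also have "\<dots> = (\<Union>x\<in>convex hull (exp_vec ` F). \<Union>y\<in>{z. \<forall>i. 0 \<le> z $ i}. {x + y})"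
    unfolding convex_hull_range_exp_vec by (auto simp: set_plus_def)
  also have "closed \<dots>"
  proof (rule compact_closed_sums)
    show "compact (convex hull (exp_vec ` F))"
      using F(1) by (intro finite_imp_compact_convex_hull) auto
    have "{z :: real ^ 'v. \<forall>i. 0 \<le> z $ i} = (\<Inter>i. {z. 0 \<le> z $ i})" by auto
    then show "closed {z :: real ^ 'v. \<forall>i. 0 \<le> z $ i}"
      by (auto intro!: closed_INT closed_Collect_le continuous_intros)
  qed
  finally show ?thesis .
qed

section \<open>Sumsets and dilated convex hulls\<close>

lemma msum_scaled_in_convex_hull:
  fixes W :: "('v::finite \<Rightarrow>\<^sub>0 nat) set"
  assumes W: "upset W" and "a \<in> msum W m" and "0 < m"
  shows "(1 / real m) *\<^sub>R exp_vec a \<in> convex hull (exp_vec ` W)"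
  using assms(2,3)
proof (induction m arbitrary: a)
  case (Suc m)
  then obtain c b where cb: "c \<in> W" "b \<in> msum W m" "a = c + b" by auto
  show ?case
  proof (cases "m = 0")
    case True
    \<comment> \<open>Here \<open>b\<close> is arbitrary in \<open>msum W 0 = UNIV\<close>, and
      \<open>c + b\<close> lies in \<open>W\<close> because \<open>W\<close> is an upset.\<close>
    then show ?thesis using W cb by (auto simp: upset_def intro!: hull_inc)
  next
    case False
    let ?u = "1 / real (Suc m)"
    \<comment> \<open>A running mean: the old scaled vector gets weight \<open>m / (m + 1)\<close>,
      the new point \<open>1 / (m + 1)\<close>.\<close>
    have "(1 - ?u) *\<^sub>R ((1 / real m) *\<^sub>R exp_vec b) + ?u *\<^sub>R exp_vec c \<in> convex hull (exp_vec ` W)"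
      using Suc.IH[OF cb(2)] False cb(1) by (intro convexD_alt convex_convex_hull) (auto intro: hull_inc)
    also have "(1 - ?u) *\<^sub>R ((1 / real m) *\<^sub>R exp_vec b) + ?u *\<^sub>R exp_vec c = ?u *\<^sub>R exp_vec a"
      using False by (simp add: cb(3) exp_vec_add scaleR_add_right field_simps)
    finally show ?thesis .
  qed
qed simp

lemma msum_replicate: "a \<in> W \<Longrightarrow> (\<Sum>i<n::nat. a) \<in> msum W n"
  by (induction n) (auto simp: add.commute)

lemma msum_sum:
  assumes "upset W" and "finite A" and "\<And>x. x \<in> A \<Longrightarrow> h x \<in> msum W (n x)"
  shows "(\<Sum>x\<in>A. h x) \<in> msum W (\<Sum>x\<in>A. n x)"
  using assms(2,3)
  by (induction A rule: finite_induct) (auto intro: msum_add[OF assms(1)])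

text \<open>
  Write \<open>q\<close> as a convex combination of at most \<open>n + 2\<close> points of \<open>W\<close> with weights \<open>u\<^sub>x\<close>.
  Rounding \<open>m u\<^sub>x\<close> down leaves at most \<open>n + 2\<close> summands missing out of \<open>m\<close>; copies of \<open>w\<close> replace
  them.
\<close>

lemma in_msum_if_ge:
  fixes W :: "('v::finite \<Rightarrow>\<^sub>0 nat) set"
  assumes W: "upset W" and w: "w \<in> W" and q: "q \<in> convex hull (exp_vec ` W)"
    and a: "\<And>i. real m * q $ i + real ((CARD('v) + 1) * Poly_Mapping.lookup w i)
                \<le> real (Poly_Mapping.lookup a i)"
  shows "a \<in> msum W m"
proof -
  obtain S where S: "finite S" "S \<subseteq> exp_vec ` W" "card S \<le> CARD('v) + 1" "q \<in> convex hull S"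
    using q by (subst (asm) caratheodory) auto
  obtain u where u: "\<And>x. x \<in> S \<Longrightarrow> 0 \<le> u x" "sum u S = 1" "(\<Sum>x\<in>S. u x *\<^sub>R x) = q"
    using S(4) by (subst (asm) convex_hull_finite[OF S(1)]) auto
  obtain g where g: "\<And>x. x \<in> S \<Longrightarrow> g x \<in> W" "\<And>x. x \<in> S \<Longrightarrow> exp_vec (g x) = x"
    using S(2) by (metis (no_types, lifting) image_iff subset_iff)
  define n where "n x = nat \<lfloor>real m * u x\<rfloor>" for x
  have n: "real (n x) \<le> real m * u x" "real m * u x \<le> real (n x) + 1" if "x \<in> S" for x
    using u(1)[OF that] by (auto simp: n_def)
  define N where "N = (\<Sum>x\<in>S. n x)"
  have sum_mu: "(\<Sum>x\<in>S. real m * u x) = real m" using u(2) by (simp flip: sum_distrib_left)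
  have "real N \<le> (\<Sum>x\<in>S. real m * u x)" unfolding N_def of_nat_sum by (rule sum_mono) (rule n)
  then have N_le: "N \<le> m" using sum_mu by simp
  have "(\<Sum>x\<in>S. real m * u x) \<le> (\<Sum>x\<in>S. real (n x) + 1)" by (rule sum_mono) (rule n)
  then have "real m \<le> real N + real (card S)" by (simp add: sum_mu sum.distrib N_def)
  then have mN: "m - N \<le> CARD('v) + 1" using S(3) by linarith
  define b where "b = (\<Sum>x\<in>S. \<Sum>i<n x. g x) + (\<Sum>i<m - N. w)"
  have "b \<in> msum W (N + (m - N))"
    unfolding b_def N_def by (intro msum_add msum_sum W S(1) msum_replicate g w)
  then have b: "b \<in> msum W m" using N_le by simp
  have "Poly_Mapping.lookup b i \<le> Poly_Mapping.lookup a i" for i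
  proof -
    have "real (Poly_Mapping.lookup b i)
        = (\<Sum>x\<in>S. real (n x) * x $ i) + real (m - N) * real (Poly_Mapping.lookup w i)"
      unfolding b_def by (simp add: lookup_add lookup_sum exp_vec_nth[symmetric] g(2) del: exp_vec_nth cong: sum.cong)
    \<comment> \<open>Rounding down only lowers the sum because the points of \<open>S\<close> have
      nonnegative coordinates.\<close>
    also have "(\<Sum>x\<in>S. real (n x) * x $ i) \<le> (\<Sum>x\<in>S. real m * u x * x $ i)"
      by (intro sum_mono mult_right_mono n) (use S(2) in auto)
    also have "\<dots> = real m * q $ i"
      by (simp add: u(3)[symmetric] sum_distrib_left mult.assoc)
    also have "real (m - N) * real (Poly_Mapping.lookup w i)
        \<le> real ((CARD('v) + 1) * Poly_Mapping.lookup w i)"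
      unfolding of_nat_mult[symmetric] of_nat_le_iff by (intro mult_right_mono mN) simp
    finally show ?thesis using a[of i] by simp
  qed
  then have "a = b + (a - b)"
    by (intro poly_mapping_eqI) (simp add: lookup_add lookup_minus)
  then show ?thesis using upset_msum[OF W] b by (metis upset_def)
qed

subsection \<open>The Waldschmidt constant\<close>

text \<open>The combinatorial core, for any nonempty family of upsets with a common element
  \<open>w\<close>; the polynomial ring no longer appears.\<close>

lemma min_degree_eq_lim:
  fixes W :: "'i \<Rightarrow> ('v::finite \<Rightarrow>\<^sub>0 nat) set"
  assumes ne: "A \<noteq> {}" and W: "\<And>P. P \<in> A \<Longrightarrow> upset (W P)" and w: "\<And>P. P \<in> A \<Longrightarrow> w \<in> W P"
  shows "(\<lambda>m. real (LEAST d. \<exists>a\<in>(\<Inter>P\<in>A. msum (W P) m). deg_in UNIV a = d) / real m)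
    \<longlonglongrightarrow> min_degree (\<Inter>P\<in>A. convex hull (exp_vec ` W P))"
proof -
  define Q where "Q = (\<Inter>P\<in>A. convex hull (exp_vec ` W P))"
  define deg :: "real ^ 'v \<Rightarrow> real" where "deg x = (\<Sum>i\<in>UNIV. x $ i)" for x
  have deg_exp_vec: "deg (exp_vec a) = real (deg_in UNIV a)" for a
    by (simp add: deg_def deg_in_def)
  have nonneg: "0 \<le> x $ i" if "x \<in> Q" for x i
  proof -
    obtain P where "P \<in> A" using ne by auto
    then have "x \<in> convex hull (exp_vec ` W P)" using that by (auto simp: Q_def)
    also have "\<dots> \<subseteq> convex hull range exp_vec" by (rule hull_mono) auto
    finally show ?thesis by (simp add: convex_hull_range_exp_vec)
  qed
  have wQ: "exp_vec w \<in> Q" using w by (auto simp: Q_def intro: hull_inc)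
  have cont: "continuous_on B deg" for B
    unfolding deg_def by (intro continuous_intros)
  \<comment> \<open>\<open>Q\<close> is unbounded; cutting it at the degree of \<open>w\<close>
    leaves a compact set, and the points cut off have larger degree.\<close>
  define K where "K = Q \<inter> {x. deg x \<le> deg (exp_vec w)}"
  have "closed K" unfolding K_def Q_def
    by (intro closed_Int closed_INT ballI closed_convex_hull_upset W closed_Collect_le cont continuous_intros)
  moreover have "bounded K"
  proof (rule boundedI)
    fix x assume x: "x \<in> K"
    have "norm x \<le> (\<Sum>i\<in>UNIV. \<bar>x $ i\<bar>)" by (rule norm_le_l1_cart)
    also have "\<dots> = deg x" using x nonneg by (simp add: deg_def K_def)
    finally show "norm x \<le> deg (exp_vec w)" using x by (simp add: K_def)
  qed
  ultimately have "compact K" by (simp add: compact_eq_bounded_closed)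
  have wK: "exp_vec w \<in> K" using wQ by (simp add: K_def)
  then have "K \<noteq> {}" by auto
  from continuous_attains_inf[OF \<open>compact K\<close> this cont]
  obtain q where qK: "q \<in> K" and qmin: "\<And>x. x \<in> K \<Longrightarrow> deg q \<le> deg x" by auto
  have q: "q \<in> Q" using qK by (simp add: K_def)
  have q_le: "deg q \<le> deg x" if "x \<in> Q" for x
    using qmin[of x] qmin[OF wK] that by (cases "x \<in> K") (auto simp: K_def)
  have min: "min_degree Q = deg q"
    unfolding min_degree_def deg_def[symmetric] by (rule Least_equality) (use q q_le in auto)

  define V where "V m = (\<Inter>P\<in>A. msum (W P) m)" for m
  define L where "L m = (LEAST d. \<exists>a\<in>V m. deg_in UNIV a = d)" for m
  \<comment> \<open>Rounding up costs at most 1 per coordinate; the rest is the padding by copies of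
    \<open>w\<close> that \<open>in_msum_if_ge\<close> asks for.\<close>
  define C where "C = real CARD('v) + real (CARD('v) + 1) * deg (exp_vec w)"
  have upper: "\<exists>a\<in>V m. real (deg_in UNIV a) \<le> real m * deg q + C" for m
  proof -
    define a where "a = Abs_poly_mapping
      (\<lambda>i. nat \<lceil>real m * q $ i\<rceil> + (CARD('v) + 1) * Poly_Mapping.lookup w i)"
    have lookup_a: "Poly_Mapping.lookup a i
        = nat \<lceil>real m * q $ i\<rceil> + (CARD('v) + 1) * Poly_Mapping.lookup w i" for i
      unfolding a_def by (subst lookup_Abs_poly_mapping) auto
    \<comment> \<open>One vector serves every \<open>P\<close>, because \<open>q\<close> and
      \<open>w\<close> are common to the whole family.\<close>
    have "a \<in> V m" unfolding V_def
    proof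
      fix P assume P: "P \<in> A"
      show "a \<in> msum (W P) m"
      proof (rule in_msum_if_ge[OF W[OF P] w[OF P]])
        show "q \<in> convex hull (exp_vec ` W P)" using q P by (auto simp: Q_def)
        show "real m * q $ i + real ((CARD('v) + 1) * Poly_Mapping.lookup w i)
          \<le> real (Poly_Mapping.lookup a i)" for i
          unfolding lookup_a of_nat_add by (intro add_right_mono real_nat_ceiling_ge)
      qed
    qed
    moreover have "real (deg_in UNIV a)
      \<le> (\<Sum>i\<in>UNIV. real m * q $ i + 1 + real (CARD('v) + 1) * real (Poly_Mapping.lookup w i))"
      unfolding deg_in_def of_nat_sum
    proof (rule sum_mono)
      fix i
      have "0 \<le> real m * q $ i" using nonneg[OF q] by simp
      then have "real (nat \<lceil>real m * q $ i\<rceil>) \<le> real m * q $ i + 1" by linarith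
      then show "real (Poly_Mapping.lookup a i)
          \<le> real m * q $ i + 1 + real (CARD('v) + 1) * real (Poly_Mapping.lookup w i)"
        unfolding lookup_a of_nat_add of_nat_mult by simp
    qed
    moreover have "\<dots> = real m * deg q + C"
      by (simp add: sum.distrib C_def deg_def sum_distrib_left)
    ultimately show ?thesis by auto
  qed
  \<comment> \<open>\<open>upper\<close> shows that there is a candidate, so \<open>LEAST\<close>
    denotes an attained minimum.\<close>
  have L_attained: "\<exists>a\<in>V m. deg_in UNIV a = L m" for m
    unfolding L_def by (rule LeastI_ex) (use upper in blast)
  have L_upper: "real (L m) \<le> real m * deg q + C" for m
  proof -
    obtain a where "a \<in> V m" "real (deg_in UNIV a) \<le> real m * deg q + C" using upper by blast
    moreover from this have "L m \<le> deg_in UNIV a" unfolding L_def by (intro Least_le) blast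
    ultimately show ?thesis by linarith
  qed
  have L_lower: "deg q \<le> real (L m) / real m" if m: "0 < m" for m
  proof -
    obtain a where a: "a \<in> V m" "deg_in UNIV a = L m" using L_attained by blast
    then have "(1 / real m) *\<^sub>R exp_vec a \<in> Q"
      unfolding Q_def V_def using m W by (auto intro!: msum_scaled_in_convex_hull)
    then have "deg q \<le> deg ((1 / real m) *\<^sub>R exp_vec a)" by (rule q_le)
    also have "\<dots> = (1 / real m) * deg (exp_vec a)" by (simp only: deg_def sum_distrib_left vector_scaleR_component real_scaleR_def)
    finally show ?thesis by (simp add: deg_exp_vec a(2))
  qed
  have "(\<lambda>m. real (L m) / real m) \<longlonglongrightarrow> deg q"
  proof (rule tendsto_sandwich)
    \<comment> \<open>Bounds are required only eventually: at \<open>m = 0\<close> the quotient is 0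
      by the convention on division.\<close>
    show "\<forall>\<^sub>F m in sequentially. deg q \<le> real (L m) / real m"
      using eventually_gt_at_top[of 0] by eventually_elim (rule L_lower)
    show "\<forall>\<^sub>F m in sequentially. real (L m) / real m \<le> deg q + C / real m"
      using eventually_gt_at_top[of 0]
    proof eventually_elim
      case (elim m)
      then show ?case using L_upper[of m] by (simp add: field_simps)
    qed
    show "(\<lambda>m. deg q + C / real m) \<longlonglongrightarrow> deg q"
      using tendsto_add[OF tendsto_const lim_const_over_n[of C], of "deg q"] by simp
  qed simp
  then show ?thesis by (simp add: L_def V_def min flip: Q_def)
qed

theorem corollary6p3:
  fixes I :: "(('v::{finite,linorder} \<Rightarrow>\<^sub>0 nat) \<Rightarrow>\<^sub>0 'k::field) set"
  assumes "monomial_ideal I" and "I \<noteq> {0}" and "I \<noteq> UNIV"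
  shows "min_degree (symbolic_polyhedron I) = waldschmidt_constant I"
proof -
  obtain U where U: "upset U" and I: "I = poly_supp U"
    using monomial_idealE[OF assms(1)] .
  \<comment> \<open>An upset containing 0 is everything, which would make \<open>I\<close> the whole
    ring.\<close>
  have "0 \<notin> U"
    using U assms(3) by (auto simp: I poly_supp_def upset_def)
  then have "Ass I \<noteq> {}" unfolding I by (rule Ass_nonempty[OF U])
  \<comment> \<open>Keeps the intersections below from ranging over an empty family.\<close>
  then have ne: "maxAss I \<noteq> {}" using exists_maxAss_above[OF U] unfolding I by blast
  obtain w where w: "w \<in> U"
    using assms(2) by (cases "U = {}") (auto simp: I poly_supp_def)
  have "contracted_local I P = poly_supp (sat (vars_in P) U)" if "P \<in> maxAss I" for P
    using that unfolding I by (intro contracted_local_poly_supp U) (auto simp: maxAss_def Ass_def)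
  then have Q: "symbolic_polyhedron I = (\<Inter>P\<in>maxAss I. convex hull (exp_vec ` sat (vars_in P) U))"
    by (simp add: symbolic_polyhedron_def lattice_points_poly_supp)
  have V: "initial_degree (symbolic_power I m)
      = (LEAST d. \<exists>a\<in>(\<Inter>P\<in>maxAss I. msum (sat (vars_in P) U) m). deg_in UNIV a = d)" for m
    unfolding I symbolic_power_poly_supp[OF U] Inter_Ass_eq_Inter_maxAss[OF U]
      initial_degree_poly_supp ..
  \<comment> \<open>Saturation only enlarges \<open>U\<close>, so one exponent of \<open>I\<close>
    is common to all the sets.\<close>
  have "w \<in> sat S U" for S using subset_sat w by blast
  then show ?thesis
    unfolding waldschmidt_constant_def Q V
    by (intro limI[symmetric] min_degree_eq_lim ne upset_sat U)
qed

end
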